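(* Let $c>1$ be a constant, let $s=s(n)\ge1$ be an integer, and let $G$ be a random graph from $G(n,p)$ with $p=\frac{c\log n}{n}$. Give each edge of $G$ a color from $[s]$ independently and uniformly at random. If $$s\le \frac{\log n}{\log c-1+\log\log n}-\frac12+\frac{\log\log\log n}{3\log\log n},$$ then asymptotically almost surely $G$ is not rainbow connected.
   Context: $\log$ is the natural logarithm. A path in the edge-colored graph $G$ is rainbow if its edges have pairwise distinct colors; $G$ is rainbow connected if every pair of distinct vertices is joined by a rainbow path. "Asymptotically almost surely" means with probability tending to $1$ as $n\to\infty$. *)

theory Defs
  imports "HOL-Probability.Probability" "HOL-Probability.Product_PMF"
begin

definition all_edges :: "nat \<Rightarrow> nat set set" where
  "all_edges n = {e. e \<subseteq> {..<n} \<and> card e = 2}"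

text \<open>The random graph \<open>G(n,p)\<close>, given by its edge set; the vertex set is \<open>{..<n}\<close>.
  As \<open>bernoulli_pmf\<close> truncates its parameter to \<open>[0,1]\<close>, this is the usual \<open>G(n,p)\<close>
  only for \<open>0 \<le> p \<le> 1\<close>; for \<open>p = c * ln n / n\<close> this holds for all large \<open>n\<close>.\<close>
definition gnp_pmf :: "nat \<Rightarrow> real \<Rightarrow> nat set set pmf" where
  "gnp_pmf n p =
     map_pmf (\<lambda>f. {e \<in> all_edges n. f e})
       (Pi_pmf (all_edges n) False (\<lambda>_. bernoulli_pmf p))"

text \<open>The value \<open>0\<close>, which is not a color, is the default of a coloring outside the edge set.\<close>
definition coloring_pmf :: "nat set set \<Rightarrow> nat \<Rightarrow> (nat set \<Rightarrow> nat) pmf" where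
  "coloring_pmf E s = Pi_pmf E 0 (\<lambda>_. pmf_of_set {1..s})"

definition colored_gnp_pmf ::
    "nat \<Rightarrow> real \<Rightarrow> nat \<Rightarrow> (nat set set \<times> (nat set \<Rightarrow> nat)) pmf" where
  "colored_gnp_pmf n p s =
     do { E \<leftarrow> gnp_pmf n p; col \<leftarrow> coloring_pmf E s; return_pmf (E, col) }"

fun path_edges :: "'a list \<Rightarrow> 'a set list" where
  "path_edges [] = []"
| "path_edges [x] = []"
| "path_edges (x # y # xs) = {x, y} # path_edges (y # xs)"

definition is_path :: "'a set \<Rightarrow> 'a set set \<Rightarrow> 'a list \<Rightarrow> bool" where
  "is_path V E xs \<longleftrightarrow>
     xs \<noteq> [] \<and> distinct xs \<and> set xs \<subseteq> V \<and> set (path_edges xs) \<subseteq> E"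

definition rainbow :: "('a set \<Rightarrow> 'c) \<Rightarrow> 'a list \<Rightarrow> bool" where
  "rainbow col xs \<longleftrightarrow> distinct (map col (path_edges xs))"

definition rainbow_connected :: "'a set \<Rightarrow> 'a set set \<Rightarrow> ('a set \<Rightarrow> 'c) \<Rightarrow> bool" where
  "rainbow_connected V E col \<longleftrightarrow>
     (\<forall>u\<in>V. \<forall>v\<in>V. u \<noteq> v \<longrightarrow>
        (\<exists>xs. is_path V E xs \<and> hd xs = u \<and> last xs = v \<and> rainbow col xs))"

end

theory Submission
  imports Defs "HOL-Real_Asymp.Real_Asymp"
begin

text \<open>
  The expected number of rainbow paths between two fixed vertices tends to \<open>0\<close>. With \<open>d = n p\<close>, there
  are at most \<open>n ^ (l - 1)\<close> candidates with \<open>l\<close> edges, each present with probability \<open>p ^ l\<close> and then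
  rainbow with probability \<open>s! / ((s - l)! s ^ l)\<close>. Summing over \<open>l\<close> and reversing the order of
  summation produces a partial sum of \<open>exp (s / d)\<close>, so the expectation is at most
  \<open>s! (d / s) ^ s exp (s / d) / n\<close>, which by Stirling is \<open>O(sqrt s * (d / e) ^ s / n)\<close>.
  For the largest \<open>s\<close> allowed, its logarithm is about \<open>- ln (ln (ln n)) / 6\<close>.
\<close>

section \<open>Edge lists of paths\<close>

lemma length_path_edges: "length (path_edges xs) = length xs - 1"
  by (induction xs rule: path_edges.induct) auto

lemma path_edges_subset: "e \<in> set (path_edges xs) \<Longrightarrow> e \<subseteq> set xs"
  by (induction xs rule: path_edges.induct) auto

lemma distinct_path_edges: "distinct xs \<Longrightarrow> distinct (path_edges xs)"
proof (induction xs rule: path_edges.induct)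
  case (3 x y xs)
  have "{x, y} \<notin> set (path_edges (y # xs))"
    using path_edges_subset[of "{x, y}" "y # xs"] "3.prems" by auto
  then show ?case using 3 by simp
qed auto

lemma card_path_edge: "distinct xs \<Longrightarrow> e \<in> set (path_edges xs) \<Longrightarrow> card e = 2"
  by (induction xs rule: path_edges.induct) auto

lemma path_edges_subset_all_edges:
  assumes "distinct xs" "set xs \<subseteq> {..<n}"
  shows "set (path_edges xs) \<subseteq> all_edges n"
  using assms path_edges_subset card_path_edge unfolding all_edges_def by fastforce

lemma finite_all_edges: "finite (all_edges n)"
  unfolding all_edges_def by (rule finite_subset[of _ "Pow {..<n}"]) auto

section \<open>Probability that a fixed path is present and rainbow\<close>

text \<open>The binomial form, unlike the product \<open>\<Prod>{card A - l + 1..card A}\<close>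
  with truncated subtraction, vanishes for \<open>l > card A\<close>. Paths with more edges than
  colors thus need no separate treatment.\<close>

lemma card_distinct_lists:
  assumes "finite A"
  shows "card {xs. length xs = l \<and> distinct xs \<and> set xs \<subseteq> A} = (card A choose l) * fact l"
proof (cases "l \<le> card A")
  case True
  have "(card A choose l) * fact l * fact (card A - l) = (fact (card A) :: nat)"
    using binomial_fact_lemma[OF True] by (simp add: mult_ac)
  moreover have "\<Prod>{card A - l + 1..card A} * fact (card A - l) = (fact (card A) :: nat)"
    using fact_div_fact[of "card A - l" "card A"] fact_dvd[of "card A - l" "card A", where ?'a = nat]
    by (metis diff_le_self dvd_div_mult_self)
  ultimately have "(card A choose l) * fact l = \<Prod>{card A - l + 1..card A}"
    by (metis fact_nonzero mult_cancel_right)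
  then show ?thesis
    using card_lists_distinct_length_eq[OF assms True] by simp
next
  case False
  have "{xs. length xs = l \<and> distinct xs \<and> set xs \<subseteq> A} = {}"
    using False assms by (auto dest: card_mono simp: distinct_card)
  then show ?thesis using False by (simp only: card.empty) (simp add: binomial_eq_0)
qed

text \<open>Only the colors on \<open>es\<close> matter: restricted to \<open>es\<close>, the
  coloring is uniform on \<open>s ^ length es\<close> functions, and the favorable ones inject into
  the repetition-free lists of colors.\<close>

lemma prob_rainbow_edges_le:
  assumes E: "finite E" and es: "distinct es" "set es \<subseteq> E" and s: "s \<ge> 1"
  shows "measure_pmf.prob (coloring_pmf E s) {col. distinct (map col es)}
    \<le> real ((s choose length es) * fact (length es)) / real s ^ length es"
proof -
  let ?F = "set es" and ?r = "\<lambda>f x. if x \<in> set es then f x else (0::nat)"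
  let ?D = "PiE_dflt ?F 0 (\<lambda>_. {1..s})"
  have fin: "finite ?D" by (intro finite_PiE_dflt) auto
  have card_D: "card ?D = s ^ length es"
    using es by (subst card_PiE_dflt) (auto simp: distinct_card)
  have ne: "?D \<noteq> {}" using card_D s by force
  have restrict: "map_pmf ?r (coloring_pmf E s) = pmf_of_set ?D"
    unfolding coloring_pmf_def using s
    by (subst Pi_pmf_subset[OF E es(2), symmetric]) (auto intro!: Pi_pmf_of_set)
  have "{col. distinct (map col es)} = ?r -` {col. distinct (map col es)}"
    by (auto simp: distinct_map inj_on_def)
  then have "measure_pmf.prob (coloring_pmf E s) {col. distinct (map col es)} =
      measure_pmf.prob (pmf_of_set ?D) {col. distinct (map col es)}"
    unfolding restrict[symmetric] measure_map_pmf by (rule arg_cong)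
  also have "\<dots> = real (card (?D \<inter> {col. distinct (map col es)})) / real s ^ length es"
    by (subst measure_pmf_of_set[OF ne fin]) (simp only: card_D of_nat_power)
  also have "card (?D \<inter> {col. distinct (map col es)})
      \<le> card {xs. length xs = length es \<and> distinct xs \<and> set xs \<subseteq> {1..s}}"
  proof (rule card_inj_on_le)
    \<comment> \<open>Outside \<open>es\<close> all functions in \<open>?D\<close> take the default
      \<open>0\<close>, so the list of values on \<open>es\<close> determines them.\<close>
    show "inj_on (\<lambda>col. map col es) (?D \<inter> {col. distinct (map col es)})"
    proof (rule inj_onI)
      fix f g assume fg: "f \<in> ?D \<inter> {col. distinct (map col es)}"
        "g \<in> ?D \<inter> {col. distinct (map col es)}" and eq: "map f es = map g es"
      show "f = g"
      proof
        fix x show "f x = g x"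
          using fg eq by (cases "x \<in> set es") (auto simp: PiE_dflt_def)
      qed
    qed
    show "(\<lambda>col. map col es) ` (?D \<inter> {col. distinct (map col es)})
        \<subseteq> {xs. length xs = length es \<and> distinct xs \<and> set xs \<subseteq> {1..s}}"
      by (fastforce simp: PiE_dflt_def)
    show "finite {xs. length xs = length es \<and> distinct xs \<and> set xs \<subseteq> {1..s}}"
      by (rule finite_subset[OF _ finite_lists_length_eq[of "{1..s}" "length es"]]) auto
  qed
  also have "\<dots> = (s choose length es) * fact (length es)"
    by (subst card_distinct_lists) auto
  finally show ?thesis by (simp add: divide_right_mono)
qed

text \<open>The event is a box: coordinates in \<open>F\<close> are forced to \<open>True\<close>
  and the others are free, so independence gives a product.\<close>

lemma prob_gnp_subset:
  assumes "F \<subseteq> all_edges n" "0 \<le> p" "p \<le> 1"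
  shows "measure_pmf.prob (gnp_pmf n p) {E. F \<subseteq> E} = p ^ card F"
proof -
  let ?P = "Pi_pmf (all_edges n) False (\<lambda>_. bernoulli_pmf p)"
  have "measure_pmf.prob (gnp_pmf n p) {E. F \<subseteq> E} =
      measure_pmf.prob ?P (Pi (all_edges n) (\<lambda>e. if e \<in> F then {True} else UNIV))"
    unfolding gnp_pmf_def using assms(1)
    by (auto intro!: arg_cong[where f = "measure_pmf.prob _"] simp: Pi_def split: if_splits)
  also have "\<dots> = (\<Prod>e\<in>all_edges n. measure_pmf.prob (bernoulli_pmf p) (if e \<in> F then {True} else UNIV))"
    by (rule measure_Pi_pmf_Pi[OF finite_all_edges])
  also have "\<dots> = (\<Prod>e\<in>all_edges n. if e \<in> F then p else 1)"
    using assms by (intro prod.cong) (auto simp: measure_pmf_single)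
  also have "\<dots> = p ^ card F"
    using assms(1) finite_all_edges[of n] by (simp add: prod.If_cases Int_absorb1)
  finally show ?thesis .
qed

text \<open>Condition on the edge set \<open>E\<close>. The conditional probability is 0 if
  \<open>E\<close> misses an edge of the path; otherwise the coloring bound applies, and it does not
  depend on \<open>E\<close>.\<close>

lemma prob_rainbow_path_le:
  assumes xs: "distinct xs" "set xs \<subseteq> {..<n}" and p: "0 \<le> p" "p \<le> 1" and s: "s \<ge> 1"
  defines "l \<equiv> length xs - 1"
  shows "measure_pmf.prob (colored_gnp_pmf n p s)
      {(E, col). is_path {..<n} E xs \<and> rainbow col xs}
    \<le> p ^ l * (real ((s choose l) * fact l) / real s ^ l)"
proof -
  let ?es = "path_edges xs"
  let ?q = "real ((s choose l) * fact l) / real s ^ l"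
  let ?A = "{(E, col). is_path {..<n} E xs \<and> rainbow col xs}"
  note es = distinct_path_edges[OF xs(1)] path_edges_subset_all_edges[OF xs]
  have len: "length ?es = l" by (simp add: length_path_edges l_def)
  have le: "measure_pmf.prob (map_pmf (Pair E) (coloring_pmf E s)) ?A
      \<le> indicator {E. set ?es \<subseteq> E} E * ?q" if "E \<in> set_pmf (gnp_pmf n p)" for E
  proof (cases "set ?es \<subseteq> E")
    case True
    have "E \<subseteq> all_edges n" using that by (auto simp: gnp_pmf_def)
    then have E: "finite E" using finite_all_edges finite_subset by blast
    have "measure_pmf.prob (map_pmf (Pair E) (coloring_pmf E s)) ?A
        \<le> measure_pmf.prob (coloring_pmf E s) {col. distinct (map col ?es)}"
      by (auto simp: rainbow_def intro!: measure_pmf.finite_measure_mono)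
    also have "\<dots> \<le> ?q"
      using prob_rainbow_edges_le[OF E es(1) True s] unfolding len .
    finally show ?thesis using True by simp
  next
    case False
    then show ?thesis by (simp add: is_path_def vimage_def)
  qed
  have "measure_pmf.prob (colored_gnp_pmf n p s) ?A =
     measure_pmf.expectation (gnp_pmf n p)
       (\<lambda>E. measure_pmf.prob (map_pmf (Pair E) (coloring_pmf E s)) ?A)"
    unfolding colored_gnp_pmf_def map_pmf_def[symmetric] measure_pmf_bind
    by (subst measure_pmf.measure_bind[where N = "count_space UNIV"])
       (auto simp: measure_pmf_in_subprob_algebra)
  also have "\<dots> \<le> measure_pmf.expectation (gnp_pmf n p)
       (\<lambda>E. indicator {E. set ?es \<subseteq> E} E * ?q)"
  proof (rule integral_mono_AE)
    show "integrable (gnp_pmf n p) (\<lambda>E. indicator {E. set ?es \<subseteq> E} E * ?q)"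
      by (intro integrable_mult_left integrable_real_indicator)
         (auto simp: measure_pmf.emeasure_eq_measure)
    show "integrable (gnp_pmf n p)
        (\<lambda>E. measure_pmf.prob (map_pmf (Pair E) (coloring_pmf E s)) ?A)"
      by (rule measure_pmf.integrable_const_bound[where B = 1]) auto
  qed (use le in \<open>simp only: AE_measure_pmf_iff, blast\<close>)
  also have "\<dots> = measure_pmf.prob (gnp_pmf n p) {E. set ?es \<subseteq> E} * ?q"
    by simp
  also have "\<dots> = p ^ l * ?q"
    by (subst prob_gnp_subset[OF es(2) p]) (simp add: distinct_card[OF es(1)] len)
  finally show ?thesis .
qed

section \<open>Union bound over all paths between two vertices\<close>

lemma prob_rainbow_connected_le:
  assumes n: "n \<ge> 2" and p: "0 \<le> p" "p \<le> 1" and s: "s \<ge> 1"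
  shows "measure_pmf.prob (colored_gnp_pmf n p s) {(E, col). rainbow_connected {..<n} E col}
    \<le> (\<Sum>k\<le>n. real n ^ k * (p ^ Suc k * (real ((s choose Suc k) * fact (Suc k)) / real s ^ Suc k)))"
proof -
  let ?M = "measure_pmf.prob (colored_gnp_pmf n p s)"
  let ?q = "\<lambda>k. p ^ Suc k * (real ((s choose Suc k) * fact (Suc k)) / real s ^ Suc k)"
  \<comment> \<open>The endpoints are fixed as 0 and 1. The list \<open>ys\<close> holds the
    interior vertices, so \<open>k\<close> of them give a path with \<open>Suc k\<close>
    edges.\<close>
  let ?A = "\<lambda>ys. {(E, col :: nat set \<Rightarrow> nat). is_path {..<n} E (0 # ys @ [1]) \<and> rainbow col (0 # ys @ [1])}"
  let ?I = "\<lambda>k. {ys. set ys \<subseteq> {..<n} \<and> length ys = k}"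
  have fin: "finite (?I k)" for k by (rule finite_lists_length_eq) simp
  have "{(E, col). rainbow_connected {..<n} E col} \<subseteq> (\<Union>k\<le>n. \<Union>ys\<in>?I k. ?A ys)"
  proof (rule subrelI)
    fix E :: "nat set set" and col :: "nat set \<Rightarrow> nat"
    assume "(E, col) \<in> {(E, col). rainbow_connected {..<n} E col}"
    then have "rainbow_connected {..<n} E col" by simp
    moreover have "(0::nat) \<in> {..<n}" "(1::nat) \<in> {..<n}" "(0::nat) \<noteq> 1"
      using n by auto
    ultimately obtain xs where xs: "is_path {..<n} E xs" "hd xs = 0" "last xs = 1" "rainbow col xs"
      unfolding rainbow_connected_def by blast
    then have "xs \<noteq> []" by (simp add: is_path_def)
    then obtain zs where zs: "xs = 0 # zs" using xs(2) by (cases xs) auto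
    then have "zs \<noteq> []" "last zs = 1" using xs(3) by (auto split: if_splits)
    then obtain ys where ys: "xs = 0 # ys @ [1]"
      using zs by (metis append_butlast_last_id)
    have "card (set ys) \<le> card {..<n}"
      using xs(1) ys by (intro card_mono) (auto simp: is_path_def)
    then have "length ys \<le> n"
      using xs(1) ys by (simp add: is_path_def distinct_card)
    moreover have "set ys \<subseteq> {..<n}" using xs(1) ys by (auto simp: is_path_def)
    ultimately show "(E, col) \<in> (\<Union>k\<le>n. \<Union>ys\<in>?I k. ?A ys)"
      using xs ys by auto
  qed
  then have "?M {(E, col). rainbow_connected {..<n} E col} \<le> ?M (\<Union>k\<le>n. \<Union>ys\<in>?I k. ?A ys)"
    by (intro measure_pmf.finite_measure_mono) auto
  also have "\<dots> \<le> (\<Sum>k\<le>n. ?M (\<Union>ys\<in>?I k. ?A ys))"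
    by (intro measure_pmf.finite_measure_subadditive_finite) auto
  also have "\<dots> \<le> (\<Sum>k\<le>n. \<Sum>ys\<in>?I k. ?M (?A ys))"
    by (intro sum_mono measure_pmf.finite_measure_subadditive_finite fin) auto
  also have "\<dots> \<le> (\<Sum>k\<le>n. \<Sum>ys\<in>?I k. ?q k)"
  proof (intro sum_mono)
    fix k ys assume ys: "ys \<in> ?I k"
    show "?M (?A ys) \<le> ?q k"
    proof (cases "distinct (0 # ys @ [1])")
      case True
      have "set (0 # ys @ [1]) \<subseteq> {..<n}" using ys n by auto
      from prob_rainbow_path_le[OF True this p s] ys show ?thesis by simp
    next
      \<comment> \<open>The factor \<open>n ^ k\<close> also counts lists with repeated vertices;
        these are no paths, so their event is empty.\<close>
      case False
      then have "?A ys = {}" by (auto simp: is_path_def)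
      then show ?thesis using p by (simp only: measure_empty) (simp del: fact_Suc)
    qed
  qed
  also have "\<dots> = (\<Sum>k\<le>n. real n ^ k * ?q k)"
    by (simp add: card_lists_length_eq del: fact_Suc)
  finally show ?thesis .
qed

section \<open>Analytic estimates\<close>

text \<open>With x = s/d, the term with l edges equals s! (d/s)^s times x^(s-l) / (s-l)!, a term of
  the exponential series in j = s - l.\<close>

lemma sum_falling_factorial_le:
  assumes d: "d > 0" and s: "s \<ge> 1"
  shows "(\<Sum>k\<le>n. d ^ Suc k * (real ((s choose Suc k) * fact (Suc k)) / real s ^ Suc k))
    \<le> fact s * (d / real s) ^ s * exp (real s / d)"
proof -
  let ?x = "real s / d"
  let ?f = "\<lambda>l. d ^ l * (real ((s choose l) * fact l) / real s ^ l)"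
  have eq: "?f l = fact s * (d / real s) ^ s * (?x ^ (s - l) /\<^sub>R fact (s - l))" if "l \<le> s" for l
  proof -
    have "real ((s choose l) * fact l) = fact s / fact (s - l)"
      using binomial_fact[OF that, where ?'a = real] by simp
    moreover have "(d / real s) ^ s * ?x ^ (s - l) = (d / real s) ^ l"
    proof -
      have "(d / real s) ^ s = (d / real s) ^ l * (d / real s) ^ (s - l)"
        using that by (simp flip: power_add)
      moreover have "(d / real s) ^ (s - l) * ?x ^ (s - l) = 1"
        using d s by (simp flip: power_mult_distrib)
      ultimately show ?thesis by simp
    qed
    ultimately show ?thesis
      using d s by (simp add: field_simps)
  qed
  have "(\<Sum>k\<le>n. ?f (Suc k)) = (\<Sum>l\<in>Suc ` {..n}. ?f l)"
    by (subst sum.reindex) (auto simp del: fact_Suc)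
  \<comment> \<open>The range is enlarged to contain 0..s as well; terms with \<open>l > s\<close>
    vanish with the binomial coefficient, so the bound becomes independent of
    \<open>n\<close>.\<close>
  also have "\<dots> \<le> (\<Sum>l\<le>max s (Suc n). ?f l)"
    using d by (intro sum_mono2) auto
  also have "\<dots> = (\<Sum>l\<le>s. ?f l)"
    by (rule sum.mono_neutral_right) (auto simp: binomial_eq_0)
  also have "\<dots> = (\<Sum>l\<le>s. fact s * (d / real s) ^ s * (?x ^ (s - l) /\<^sub>R fact (s - l)))"
    by (intro sum.cong eq) auto
  also have "\<dots> = (\<Sum>j\<le>s. fact s * (d / real s) ^ s * (?x ^ j /\<^sub>R fact j))"
    by (rule sum.reindex_bij_witness[of _ "\<lambda>j. s - j" "\<lambda>j. s - j"]) auto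
  also have "\<dots> = fact s * (d / real s) ^ s * (\<Sum>j\<le>s. ?x ^ j /\<^sub>R fact j)"
    by (simp add: sum_distrib_left)
  also have "(\<Sum>j\<le>s. ?x ^ j /\<^sub>R fact j) \<le> exp ?x"
    unfolding exp_def using d
    by (intro sum_le_suminf summable_exp_generic) auto
  finally show ?thesis using d by (simp add: mult_left_mono)
qed

text \<open>The difference has derivative y^2 / ((1+y) (2+y)^2). At x = 1/m the bound is exactly 1 /
  (m + 1/2), as the induction for Stirling's bound requires.\<close>

lemma ln_add_one_ge_two_mult_div:
  fixes x :: real
  assumes "x \<ge> 0"
  shows "2 * x / (2 + x) \<le> ln (1 + x)"
proof -
  let ?f = "\<lambda>x::real. ln (1 + x) - 2 * x / (2 + x)"
  have "?f 0 \<le> ?f x"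
  proof (rule DERIV_nonneg_imp_nondecreasing[OF assms])
    fix y :: real assume y: "0 \<le> y" "y \<le> x"
    have "(?f has_real_derivative 1 / (1 + y) - 4 / (2 + y)\<^sup>2) (at y)"
      using y by (auto intro!: derivative_eq_intros simp: field_simps power2_eq_square)
    moreover have "1 / (1 + y) - 4 / (2 + y)\<^sup>2 \<ge> 0"
    proof -
      have "4 * (1 + y) \<le> (2 + y)\<^sup>2" by (simp add: power2_eq_square algebra_simps)
      then show ?thesis using y by (simp add: field_simps)
    qed
    ultimately show "\<exists>D. (?f has_real_derivative D) (at y) \<and> 0 \<le> D" by blast
  qed
  then show ?thesis by simp
qed

text \<open>From m to m + 1 the right side grows by the factor (m+1) (1 + 1/m)^(m + 1/2) / e, which
  is at least m + 1. The constant \<open>exp 1\<close> gives equality at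
  \<open>s = 1\<close>.\<close>

lemma fact_le_stirling:
  assumes "s \<ge> 1"
  shows "fact s \<le> exp 1 * sqrt (real s) * (real s / exp 1) ^ s"
  using assms
proof (induction s rule: dec_induct)
  case base
  show ?case by simp
next
  case (step m)
  have m: "real m > 0" using step by simp
  have "1 \<le> (real m + 1 / 2) * ln (1 + 1 / real m)"
    using ln_add_one_ge_two_mult_div[of "1 / real m"] m by (simp add: field_simps)
  then have "exp 1 \<le> exp (real m * ln (1 + 1 / real m) + ln (1 + 1 / real m) / 2)"
    by (simp add: algebra_simps)
  also have "\<dots> = (1 + 1 / real m) ^ m * sqrt (1 + 1 / real m)"
    using m by (simp add: exp_add exp_of_nat_mult ln_sqrt[symmetric] add_pos_pos)
  finally have "exp 1 * (sqrt (real m) * real m ^ m) \<le>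
      ((1 + 1 / real m) ^ m * sqrt (1 + 1 / real m)) * (sqrt (real m) * real m ^ m)"
    by (intro mult_right_mono) auto
  also have "\<dots> = ((1 + 1 / real m) * real m) ^ m * sqrt ((1 + 1 / real m) * real m)"
    by (simp only: power_mult_distrib real_sqrt_mult mult_ac)
  also have "(1 + 1 / real m) * real m = real (Suc m)"
    using m by (simp add: field_simps)
  finally have key: "exp 1 * (sqrt (real m) * real m ^ m) \<le> real (Suc m) ^ m * sqrt (real (Suc m))" .
  have "fact (Suc m) \<le> real (Suc m) * (exp 1 * sqrt (real m) * (real m / exp 1) ^ m)"
    using step.IH by (simp only: fact_Suc) (intro mult_left_mono, auto)
  also have "\<dots> = real (Suc m) / exp 1 ^ m * (exp 1 * (sqrt (real m) * real m ^ m))"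
    by (simp add: power_divide)
  also have "\<dots> \<le> real (Suc m) / exp 1 ^ m * (real (Suc m) ^ m * sqrt (real (Suc m)))"
    by (intro mult_left_mono key) auto
  also have "\<dots> = exp 1 * sqrt (real (Suc m)) * (real (Suc m) / exp 1) ^ Suc m"
    by (simp add: power_divide)
  finally show ?case .
qed

lemma prob_rainbow_connected_le_stirling:
  assumes n: "n \<ge> 2" and d: "0 < d" "d \<le> real n" and s: "s \<ge> 1"
  shows "measure_pmf.prob (colored_gnp_pmf n (d / real n) s)
      {(E, col). rainbow_connected {..<n} E col}
    \<le> exp 1 * sqrt (real s) * exp ((ln d - 1) * real s) * exp (real s / d) / real n"
proof -
  have "measure_pmf.prob (colored_gnp_pmf n (d / real n) s)
      {(E, col). rainbow_connected {..<n} E col} \<le>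
    (\<Sum>k\<le>n. real n ^ k * ((d / real n) ^ Suc k *
      (real ((s choose Suc k) * fact (Suc k)) / real s ^ Suc k)))"
    using n d s by (intro prob_rainbow_connected_le) auto
  \<comment> \<open>A path has one more edge than interior vertices, which leaves the factor
    1/n.\<close>
  also have "\<dots> = (\<Sum>k\<le>n. d ^ Suc k * (real ((s choose Suc k) * fact (Suc k)) / real s ^ Suc k)) / real n"
    using n by (simp add: sum_divide_distrib power_divide mult_ac del: fact_Suc)
  also have "\<dots> \<le> fact s * (d / real s) ^ s * exp (real s / d) / real n"
    using d s by (intro divide_right_mono sum_falling_factorial_le) auto
  also have "\<dots> \<le> exp 1 * sqrt (real s) * (real s / exp 1) ^ s * (d / real s) ^ s * exp (real s / d) / real n"
    using d s by (intro divide_right_mono mult_right_mono fact_le_stirling) auto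
  also have "(real s / exp 1) ^ s * (d / real s) ^ s = (d / exp 1) ^ s"
    using s by (simp flip: power_mult_distrib)
  then have "exp 1 * sqrt (real s) * (real s / exp 1) ^ s * (d / real s) ^ s = exp 1 * sqrt (real s) * (d / exp 1) ^ s"
    by (simp only: mult.assoc)
  also have "(d / exp 1) ^ s = exp ((ln d - 1) * real s)"
    using d by (simp add: exp_of_nat2_mult exp_diff)
  finally show ?thesis .
qed

text \<open>Here \<open>t\<close> is \<open>ln n\<close>, \<open>C\<close> is \<open>ln c - 1\<close>, and the exponential is \<open>exp ((C + ln t) * B) / n\<close> for the
  largest admissible number \<open>B\<close> of colors.\<close>
lemma stirling_bound_tendsto_0:
  fixes C :: real
  shows "((\<lambda>t::real. sqrt (t / (C + ln t) - 1 / 2 + ln (ln t) / (3 * ln t)) *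
    exp (- (C + ln t) / 2 + (C + ln t) * (ln (ln t) / (3 * ln t)))) \<longlongrightarrow> 0) at_top"
  by real_asymp

section \<open>Passage to the limit\<close>

theorem theorem5p1:
  fixes c :: real and s :: "nat \<Rightarrow> nat"
  assumes "c > 1"
    and "\<And>n. s n \<ge> 1"
    and "\<forall>\<^sub>F n in sequentially.
           real (s n) \<le> ln (real n) / (ln c - 1 + ln (ln (real n))) - 1 / 2
             + ln (ln (ln (real n))) / (3 * ln (ln (real n)))"
  shows "(\<lambda>n. measure_pmf.prob (colored_gnp_pmf n (c * ln (real n) / real n) (s n))
           {(E, col). \<not> rainbow_connected {..<n} E col}) \<longlonglongrightarrow> 1"
proof -
  define C where "C = ln c - 1"
  define \<epsilon> where "\<epsilon> t = ln (ln t) / (3 * ln t)" for t :: real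
  define B where "B t = t / (C + ln t) - 1 / 2 + \<epsilon> t" for t
  define P where "P n = measure_pmf.prob (colored_gnp_pmf n (c * ln (real n) / real n) (s n))
    {(E, col). rainbow_connected {..<n} E col}" for n
  \<comment> \<open>One factor \<open>exp 1\<close> comes from Stirling's bound, the other bounds
    \<open>exp (s / d)\<close>.\<close>
  define U where "U t = exp 1 * exp 1 *
    (sqrt (B t) * exp (- (C + ln t) / 2 + (C + ln t) * \<epsilon> t))" for t
  have ln_top: "filterlim (\<lambda>n. ln (real n)) at_top sequentially" by real_asymp
  have "(U \<longlongrightarrow> exp 1 * exp 1 * 0) at_top"
    unfolding U_def B_def \<epsilon>_def by (intro tendsto_mult_left stirling_bound_tendsto_0)
  then have U_lim: "(\<lambda>n. U (ln (real n))) \<longlonglongrightarrow> 0"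
    using filterlim_compose[OF _ ln_top] by fastforce
  have "\<forall>\<^sub>F t in at_top. C + ln t > 0" by real_asymp
  \<comment> \<open>This gives s/d \<le> 1 for d = c ln n, so the exponential factor stays
    bounded.\<close>
  moreover have "\<forall>\<^sub>F t in at_top. B t \<le> c * t"
  proof -
    have "\<forall>\<^sub>F t in at_top. B t \<le> t" unfolding B_def \<epsilon>_def by real_asymp
    then show ?thesis using eventually_gt_at_top[of 0]
    proof eventually_elim
      case (elim t)
      have "1 * t \<le> c * t" using elim assms(1) by (intro mult_right_mono) auto
      then show ?case using elim by linarith
    qed
  qed
  ultimately have "\<forall>\<^sub>F t in at_top. C + ln t > 0 \<and> B t \<le> c * t"
    by eventually_elim simp
  then have ev: "\<forall>\<^sub>F n in sequentially. C + ln (ln (real n)) > 0 \<and> B (ln (real n)) \<le> c * ln (real n)"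
    by (rule eventually_compose_filterlim[OF _ ln_top])
  \<comment> \<open>Ensures that the edge probability is at most 1.\<close>
  have ev_p: "\<forall>\<^sub>F n in sequentially. c * ln (real n) \<le> real n" by real_asymp
  have ev_ln: "\<forall>\<^sub>F n in sequentially. ln (real n) > 0" by real_asymp
  have P_le: "\<forall>\<^sub>F n in sequentially. P n \<le> U (ln (real n))"
    using ev ev_p ev_ln eventually_ge_at_top[of 2] assms(3)
  proof eventually_elim
    case (elim n)
    let ?L = "ln (real n)"
    let ?M = "C + ln ?L" and ?d = "c * ln (real n)"
    have M: "?M > 0" and d: "?d > 0" using elim assms(1) by auto
    have sB: "real (s n) \<le> B ?L"
      using elim by (simp add: B_def \<epsilon>_def C_def)
    have ln_d: "ln ?d - 1 = ?M"
      using elim assms(1) by (simp add: ln_mult C_def)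
    \<comment> \<open>The leading term of \<open>B\<close> produces \<open>?L\<close>, which cancels
      the 1/n. With t = ln n, the -1/2 yields a factor of order t^(-1/2) against sqrt (B t), which
      is about sqrt (t / ln t), and \<open>\<epsilon>\<close> costs only about (ln t)^(1/3). The
      product is of order (ln t)^(-1/6).\<close>
    have "?M * B ?L = ?L + (- ?M / 2 + ?M * \<epsilon> ?L)"
      using M unfolding B_def by (simp add: field_simps)
    then have MB: "exp (?M * B ?L) = real n * exp (- ?M / 2 + ?M * \<epsilon> ?L)"
      using elim by (simp only: exp_add) simp
    have "P n \<le> exp 1 * sqrt (real (s n)) * exp (?M * real (s n)) * exp (real (s n) / ?d) / real n"
      unfolding P_def ln_d[symmetric] using elim d assms(2)
      by (intro prob_rainbow_connected_le_stirling) auto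
    \<comment> \<open>As \<open>?M\<close> is positive, the bound increases with the number of
      colors, so \<open>s n\<close> may be replaced by the largest admissible value.\<close>
    also have "\<dots> \<le> exp 1 * sqrt (B ?L) * exp (?M * B ?L) * exp 1 / real n"
    proof -
      have "real (s n) / ?d \<le> 1" using elim sB d by simp
      moreover have "B ?L \<ge> 0" using sB by (meson of_nat_0_le_iff order_trans)
      ultimately show ?thesis
        using sB M by (intro divide_right_mono mult_mono) auto
    qed
    also have "\<dots> = U ?L"
      unfolding MB U_def using elim by simp
    finally show ?case .
  qed
  have "P \<longlonglongrightarrow> 0"
    by (rule tendsto_sandwich[OF _ P_le tendsto_const U_lim]) (simp add: P_def)
  then have "(\<lambda>n. 1 - P n) \<longlonglongrightarrow> 1"
    using tendsto_diff[OF tendsto_const[of 1]] by fastforce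
  moreover have "measure_pmf.prob (colored_gnp_pmf n (c * ln (real n) / real n) (s n))
      {(E, col). \<not> rainbow_connected {..<n} E col} = 1 - P n" for n
  proof -
    have "{(E, col). \<not> rainbow_connected {..<n} E col} =
        (UNIV - {(E, col). rainbow_connected {..<n} E col} :: (nat set set \<times> (nat set \<Rightarrow> nat)) set)"
      by auto
    then show ?thesis
      unfolding P_def using measure_pmf.prob_compl[of "{(E, col). rainbow_connected {..<n} E col}"]
      by simp
  qed
  ultimately show ?thesis by simp
qed

end
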